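(* (1) Let $w=a^{\alpha_1}b^{\beta_1}\cdots a^{\alpha_s}b^{\beta_s}$ be a positive word in $F(a,b)$ with $s\ge 1$ and all $\alpha_i,\beta_i>0$, and let $n=\sum_{i=1}^s(\alpha_i+\beta_i)$ be its (cyclically reduced) length. Then \[ \deg f_w=n-s. \] (2) Let $0<p<1$. Let $w_n$ be a random positive word of length $n$ in $F(a,b)$ with independently chosen letters satisfying $\Pr(a)=p$ and $\Pr(b)=1-p$. Then for every $D>0$, \[ \deg f_{w_n}=\bigl(1-p(1-p)\bigr)n+O_D(\sqrt{n\log n}) \] with probability at least $1-O_D(n^{-D})$ as $n\to\infty$. In the degenerate cases $p=0$ and $p=1$ the degree of $f_{w_n}$ is exactly $n$.
   Context: $F(a,b)$ is the free group on $a,b$. For $w\in F(a,b)$ and $A,B\in \mathrm{SL}(2,\mathbb C)$, $w(A,B)$ denotes the image of $w$ under $a\mapsto A$, $b\mapsto B$. The trace polynomial $f_w(x,y,z)\in\mathbb Z[x,y,z]$ is the unique polynomial such that $\mathrm{Tr}(w(A,B))=f_w(\mathrm{Tr}A,\mathrm{Tr}B,\mathrm{Tr}(AB))$ for all $A,B\in \mathrm{SL}(2,\mathbb C)$ (its existence and uniqueness are classical). $\deg$ is total degree. A positive word is a nontrivial word in the letters $a,b$ only (no inverses). The notation $O_D(\cdot)$ means that the implicit constant may depend on $D$ (and on the fixed model, e.g. on $p$) but not on $n$; the assertion "$X_n=O_D(\sqrt{n\log n})$ with probability at least $1-O_D(n^{-D})$" means: there exist constants $C_D,C'_D>0$ such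 that for all sufficiently large $n$, $\Pr(|X_n|\le C_D\sqrt{n\log n})\ge 1-C'_Dn^{-D}$. *)

theory Defs
  imports "HOL-Analysis.Analysis" "HOL-Probability.Probability" "HOL-Library.Poly_Mapping"
begin

datatype letter = La | Lb

text \<open>A word in the letters and their inverses is a list of pairs; the pair \<open>(l, True)\<close> stands
  for the letter \<open>l\<close> and \<open>(l, False)\<close> for its inverse.\<close>

type_synonym word = "(letter \<times> bool) list"

inductive cancel :: "word \<Rightarrow> word \<Rightarrow> bool" where
  "cancel (u @ (l, e) # (l, \<not> e) # v) (u @ v)"

definition inv_word :: "word \<Rightarrow> word" where
  "inv_word u = rev (map (\<lambda>(l, e). (l, \<not> e)) u)"

lemma cancel_append_left: "cancel u v \<Longrightarrow> cancel (w @ u) (w @ v)"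
  by (erule cancel.cases) (metis append.assoc cancel.intros)

lemma cancel_append_right: "cancel u v \<Longrightarrow> cancel (u @ w) (v @ w)"
  by (erule cancel.cases) (metis append.assoc append_Cons cancel.intros)

lemma cancel_inv_word: "cancel u v \<Longrightarrow> cancel (inv_word u) (inv_word v)"
proof (erule cancel.cases)
  fix x l e y
  assume "u = x @ (l, e) # (l, \<not> e) # y" "v = x @ y"
  then show ?thesis
    using cancel.intros[of "inv_word y" l e "inv_word x"] by (simp add: inv_word_def)
qed

lemma equivclp_map:
  assumes "\<And>u v. r u v \<Longrightarrow> r (f u) (f v)" and "equivclp r u v"
  shows "equivclp r (f u) (f v)"
  using assms(2) by induction (use assms(1) in \<open>auto intro: equivclp_into_equivclp\<close>)

lemma equivclp_append:
  assumes "equivclp cancel u u'" and "equivclp cancel v v'"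
  shows "equivclp cancel (u @ v) (u' @ v')"
  using equivclp_map[of cancel "\<lambda>w. w @ v", OF cancel_append_right assms(1)]
    equivclp_map[of cancel "\<lambda>w. u' @ w", OF cancel_append_left assms(2)]
  by (rule equivclp_trans)

lemma equivclp_inv_word_append: "equivclp cancel (inv_word u @ u) []"
proof (induction u)
  case Nil
  then show ?case by (simp add: inv_word_def)
next
  case (Cons x u)
  obtain l e where x: "x = (l, e)" by fastforce
  have "cancel (inv_word (x # u) @ x # u) (inv_word u @ u)"
    using cancel.intros[of "inv_word u" l "\<not> e" u] by (simp add: x inv_word_def)
  then show ?case
    using Cons.IH by (meson r_into_equivclp equivclp_trans)
qed

quotient_type F2 = word / "equivclp cancel"
  by simp

instantiation F2 :: "{monoid_mult, inverse}"
begin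

lift_definition one_F2 :: F2 is "[]" .

lift_definition times_F2 :: "F2 \<Rightarrow> F2 \<Rightarrow> F2" is "(@)"
  by (rule equivclp_append)

lift_definition inverse_F2 :: "F2 \<Rightarrow> F2" is inv_word
  by (rule equivclp_map[of cancel inv_word, OF cancel_inv_word])

definition divide_F2 :: "F2 \<Rightarrow> F2 \<Rightarrow> F2" where
  "divide_F2 x y = x * inverse y"

instance
  by standard (transfer; simp)+

end

lemma F2_left_inverse: "inverse x * x = (1 :: F2)"
  by transfer (rule equivclp_inv_word_append)

lift_definition gen :: "letter \<Rightarrow> F2" is "\<lambda>l. [(l, True)]" .

typedef SL2 = "{A :: complex^2^2. det A = 1}"
  by (rule exI[of _ "mat 1"]) simp

setup_lifting type_definition_SL2

lemma matrix_inv_SL2: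
  fixes A :: "complex^2^2"
  assumes "det A = 1"
  shows "A ** matrix_inv A = mat 1" and "matrix_inv A ** A = mat 1" and "det (matrix_inv A) = 1"
proof -
  have *: "A ** matrix_inv A = mat 1 \<and> matrix_inv A ** A = mat 1"
    using assms invertible_det_nz[of A] unfolding invertible_def matrix_inv_def
    by (metis (mono_tags, lifting) someI_ex zero_neq_one)
  then show "A ** matrix_inv A = mat 1" and "matrix_inv A ** A = mat 1" by auto
  show "det (matrix_inv A) = 1"
    using * det_mul[of A "matrix_inv A"] assms by simp
qed

instantiation SL2 :: "{monoid_mult, inverse}"
begin

lift_definition one_SL2 :: SL2 is "mat 1"
  by simp

lift_definition times_SL2 :: "SL2 \<Rightarrow> SL2 \<Rightarrow> SL2" is "(**)"
  by (simp add: det_mul)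

lift_definition inverse_SL2 :: "SL2 \<Rightarrow> SL2" is matrix_inv
  by (rule matrix_inv_SL2)

definition divide_SL2 :: "SL2 \<Rightarrow> SL2 \<Rightarrow> SL2" where
  "divide_SL2 A B = A * inverse B"

instance
  by standard (transfer; simp add: matrix_mul_assoc)+

end

lemma SL2_inverse [simp]: "A * inverse A = (1 :: SL2)" "inverse A * A = (1 :: SL2)"
  by (transfer; simp add: matrix_inv_SL2)+

definition tr :: "SL2 \<Rightarrow> complex" where
  "tr A = trace (Rep_SL2 A)"

fun letter_value :: "SL2 \<Rightarrow> SL2 \<Rightarrow> letter \<Rightarrow> SL2" where
  "letter_value A B La = A"
| "letter_value A B Lb = B"

definition eval_word :: "SL2 \<Rightarrow> SL2 \<Rightarrow> word \<Rightarrow> SL2" where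
  "eval_word A B u =
     (\<Prod>(l, e)\<leftarrow>u. if e then letter_value A B l else inverse (letter_value A B l))"

lemma eval_word_append: "eval_word A B (u @ v) = eval_word A B u * eval_word A B v"
  by (simp add: eval_word_def)

lemma eval_word_cancel:
  assumes "cancel u v"
  shows "eval_word A B u = eval_word A B v"
  using assms
proof cases
  case (1 x l e y)
  have "eval_word A B [(l, e), (l, \<not> e)] = 1"
    by (simp add: eval_word_def)
  moreover have "u = x @ [(l, e), (l, \<not> e)] @ y"
    using 1 by simp
  ultimately show ?thesis
    using 1 by (simp only: eval_word_append mult_1_left)
qed

text \<open>\<open>word_map A B w\<close> is \<open>w(A,B)\<close>, the image of \<open>w\<close> under the homomorphism sending \<open>a\<close> to \<open>A\<close>
  and \<open>b\<close> to \<open>B\<close>.\<close>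

lift_definition word_map :: "SL2 \<Rightarrow> SL2 \<Rightarrow> F2 \<Rightarrow> SL2" is eval_word
proof -
  fix A B u v
  assume "equivclp cancel u v"
  then show "eval_word A B u = eval_word A B v"
    by induction (metis eval_word_cancel)+
qed

lemma word_map_hom:
  "word_map A B 1 = 1"
  "word_map A B (v * w) = word_map A B v * word_map A B w"
  "word_map A B (gen l) = letter_value A B l"
  by (transfer; simp add: eval_word_def)+

text \<open>Elements of \<open>\<int>[x,y,z]\<close> are finitely supported functions from exponent triples to integers:
  the triple \<open>(i, j, k)\<close> stands for the monomial \<open>x^i y^j z^k\<close>.\<close>

type_synonym poly3 = "(nat \<times> nat \<times> nat) \<Rightarrow>\<^sub>0 int"

definition eval_poly3 :: "poly3 \<Rightarrow> complex \<Rightarrow> complex \<Rightarrow> complex \<Rightarrow> complex" where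
  "eval_poly3 f x y z =
     (\<Sum>(i, j, k)\<in>Poly_Mapping.keys f. of_int (Poly_Mapping.lookup f (i, j, k)) * x ^ i * y ^ j * z ^ k)"

text \<open>The zero polynomial gets degree \<open>0\<close>.\<close>

definition total_degree :: "poly3 \<Rightarrow> nat" where
  "total_degree f = Max (insert 0 ((\<lambda>(i, j, k). i + j + k) ` Poly_Mapping.keys f))"

definition trace_poly :: "F2 \<Rightarrow> poly3" where
  "trace_poly w = (THE f. \<forall>A B. tr (word_map A B w) = eval_poly3 f (tr A) (tr B) (tr (A * B)))"

definition letter_pmf :: "real \<Rightarrow> letter pmf" where
  "letter_pmf p = map_pmf (\<lambda>c. if c then La else Lb) (bernoulli_pmf p)"

definition random_positive_word :: "real \<Rightarrow> nat \<Rightarrow> F2 pmf" where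
  "random_positive_word p n = map_pmf (\<lambda>ls. \<Prod>l\<leftarrow>ls. gen l) (replicate_pmf n (letter_pmf p))"

end

theory Submission
  imports Defs "HOL-Real_Asymp.Real_Asymp"
begin

text \<open>By Cayley--Hamilton, every word in \<open>A, B\<close> is a combination of \<open>1\<close>, \<open>B\<close>, \<open>A - x\<close>, \<open>A B\<close>
  with coefficients in \<open>\<int>[x,y,z]\<close>, and prepending a letter acts on the coefficients by a simple
  recursion. In this basis a single coefficient dominates, its leading form is one monomial with
  coefficient 1, and its degree grows with every letter except when an \<open>a\<close> is put in front of a \<open>b\<close>.
  So the degree of a word ending in \<open>b\<close> is its length minus the number of factors \<open>ab\<close>;
  any other word containing \<open>b\<close> can be rotated into that form, changing the count by at most 1.
  For a random word the number of factors \<open>ab\<close>, minus its mean \<open>p (1 - p) n\<close>, is up to a bounded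
  correction a martingale with increments bounded by 1, hence concentrated.\<close>

subsection \<open>Evaluation of integer polynomials in three variables\<close>

definition eval_monom :: "complex \<Rightarrow> complex \<Rightarrow> complex \<Rightarrow> nat \<times> nat \<times> nat \<Rightarrow> complex" where
  "eval_monom x y z m = x ^ fst m * y ^ fst (snd m) * z ^ snd (snd m)"

lemma eval_monom_add: "eval_monom x y z (m + m') = eval_monom x y z m * eval_monom x y z m'"
  by (simp add: eval_monom_def power_add)

lemma eval_poly3_superset:
  assumes "finite S" "Poly_Mapping.keys f \<subseteq> S"
  shows "eval_poly3 f x y z = (\<Sum>m\<in>S. of_int (Poly_Mapping.lookup f m) * eval_monom x y z m)"
proof -
  have "eval_poly3 f x y z
      = (\<Sum>m\<in>Poly_Mapping.keys f. of_int (Poly_Mapping.lookup f m) * eval_monom x y z m)"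
    unfolding eval_poly3_def by (intro sum.cong) (auto simp: eval_monom_def)
  also have "\<dots> = (\<Sum>m\<in>S. of_int (Poly_Mapping.lookup f m) * eval_monom x y z m)"
    using assms by (intro sum.mono_neutral_left) (auto simp: in_keys_iff)
  finally show ?thesis .
qed

lemma eval_poly3_zero [simp]: "eval_poly3 0 x y z = 0"
  by (simp add: eval_poly3_def)

lemma eval_poly3_single [simp]:
  "eval_poly3 (Poly_Mapping.single m c) x y z = of_int c * eval_monom x y z m"
  by (subst eval_poly3_superset[of "{m}"]) (auto simp: split: if_splits)

lemma eval_poly3_add [simp]: "eval_poly3 (f + g) x y z = eval_poly3 f x y z + eval_poly3 g x y z"
proof -
  let ?S = "Poly_Mapping.keys f \<union> Poly_Mapping.keys g"
  show ?thesis
    using keys_add[of f g]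
    by (simp add: eval_poly3_superset[of ?S] lookup_add sum.distrib algebra_simps)
qed

lemma eval_poly3_minus [simp]: "eval_poly3 (- f) x y z = - eval_poly3 f x y z"
  using eval_poly3_add[of f "- f" x y z] by (simp add: eq_neg_iff_add_eq_0 add.commute)

lemma eval_poly3_diff [simp]: "eval_poly3 (f - g) x y z = eval_poly3 f x y z - eval_poly3 g x y z"
  using eval_poly3_add[of f "- g" x y z] by simp

text \<open>Induction on the number of monomials, splitting off one at a time. It reduces
  multiplicativity of evaluation to products of two single terms.\<close>

lemma poly3_induct [case_names zero single_add]:
  fixes f :: poly3
  assumes "P 0" and "\<And>m c f. P f \<Longrightarrow> P (Poly_Mapping.single m c + f)"
  shows "P f"
proof (induction "card (Poly_Mapping.keys f)" arbitrary: f)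
  case 0
  then show ?case using assms(1) by simp
next
  case (Suc n)
  then have "Poly_Mapping.keys f \<noteq> {}"
    by (metis card.empty nat.distinct(1))
  then obtain m where m: "m \<in> Poly_Mapping.keys f"
    by blast
  define g where "g = f - Poly_Mapping.single m (Poly_Mapping.lookup f m)"
  have "Poly_Mapping.keys g = Poly_Mapping.keys f - {m}"
    by (auto simp: g_def in_keys_iff lookup_minus lookup_single when_def split: if_splits)
  then have "P g"
    using Suc m by (intro Suc.hyps) simp
  then show ?case
    using assms(2)[of g m "Poly_Mapping.lookup f m"] by (simp add: g_def)
qed

lemma eval_poly3_mult [simp]: "eval_poly3 (f * g) x y z = eval_poly3 f x y z * eval_poly3 g x y z"
proof (induction f rule: poly3_induct)
  case (single_add m c f)
  have "eval_poly3 (Poly_Mapping.single m c * g) x y z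
      = eval_poly3 (Poly_Mapping.single m c) x y z * eval_poly3 g x y z"
    by (induction g rule: poly3_induct) (simp_all add: distrib_left mult_single eval_monom_add)
  then show ?case
    using single_add by (simp add: distrib_right)
qed simp

lemma eval_poly3_one [simp]: "eval_poly3 1 x y z = 1"
  by (subst eval_poly3_superset[of "{0}"]) (auto simp: eval_monom_def)

text \<open>Uniqueness of base \<open>M\<close> digits with \<open>k\<close> as the leading one:
  \<open>mod\<close> and \<open>div\<close> read off first \<open>i\<close>, then
  \<open>j\<close>.\<close>

lemma radix_inj:
  fixes i j k :: nat
  assumes "i + M * (j + M * k) = i' + M * (j' + M * k')" "i < M" "j < M" "i' < M" "j' < M"
  shows "i = i' \<and> j = j' \<and> k = k'"
proof -
  have step: "u = u' \<and> v = v'" if "u + M * v = u' + M * v'" "u < M" "u' < M" for u v u' v' :: nat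
  proof -
    have "(u + M * v) mod M = (u' + M * v') mod M" "(u + M * v) div M = (u' + M * v') div M"
      using that(1) by simp_all
    then show ?thesis using that(2,3) by simp
  qed
  show ?thesis
    using step[OF assms(1,2,4)] step[of j k j' k'] assms(3,5) by blast
qed

text \<open>Kronecker substitution: putting \<open>x = u\<close>, \<open>y = u ^ M\<close>, \<open>z = u ^ (M * M)\<close> with \<open>M\<close> larger than
  all exponents keeps the monomials apart.\<close>

lemma eval_poly3_eq_zero_imp:
  assumes "\<And>x y z. eval_poly3 f x y z = 0"
  shows "f = 0"
proof (rule poly_mapping_eqI, rule ccontr)
  fix m0
  assume m0: "Poly_Mapping.lookup f m0 \<noteq> Poly_Mapping.lookup 0 m0"
  define K where "K = Poly_Mapping.keys f"
  have m0K: "m0 \<in> K" and [simp]: "finite K"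
    using m0 by (auto simp: K_def in_keys_iff)
  \<comment> \<open>The sum over the support dominates each exponent of x and y occurring in it;
    \<open>Suc\<close> makes the bound strict.\<close>
  define M where "M = Suc (\<Sum>m\<in>K. fst m + fst (snd m))"
  have bound: "fst m < M \<and> fst (snd m) < M" if "m \<in> K" for m
    using member_le_sum[of m K "\<lambda>m. fst m + fst (snd m)"] that by (auto simp: M_def)
  define e where "e m = fst m + M * (fst (snd m) + M * snd (snd m))" for m
  have inj: "m = m'" if "m \<in> K" "m' \<in> K" "e m = e m'" for m m'
    using radix_inj[of "fst m" M "fst (snd m)" "snd (snd m)" "fst m'" "fst (snd m')" "snd (snd m')"]
      bound[OF that(1)] bound[OF that(2)] that(3) by (simp add: e_def prod_eq_iff)
  define P where "P = (\<Sum>m\<in>K. monom (of_int (Poly_Mapping.lookup f m) :: complex) (e m))"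
  have "poly P u = eval_poly3 f u (u ^ M) (u ^ (M * M))" for u
    by (simp add: P_def eval_poly3_superset[of K] K_def poly_sum poly_monom eval_monom_def e_def
        power_add power_mult distrib_left mult.assoc)
  then have "P = 0"
    using assms poly_all_0_iff_0[of P] by simp
  \<comment> \<open>No other monomial of the support lands on the exponent \<open>e m0\<close>, so
    this coefficient is the nonzero coefficient of \<open>m0\<close> in \<open>f\<close>.\<close>
  moreover have "coeff P (e m0) = (\<Sum>m\<in>K. if m = m0 then of_int (Poly_Mapping.lookup f m) else 0)"
    unfolding P_def coeff_sum by (intro sum.cong) (use inj m0K in auto)
  ultimately show False
    using m0 m0K by simp
qed

subsection \<open>Existence and uniqueness of trace polynomials\<close>

text \<open>A is the companion matrix of its characteristic polynomial and B has a zero corner, so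
  that AB has diagonal entries 1/t and t; it remains to solve t + 1/t = z. As all triples occur, a
  trace identity determines its polynomial.\<close>

lemma SL2_with_traces:
  obtains A B where "tr A = x" "tr B = y" "tr (A * B) = z"
proof -
  obtain t where t: "t\<^sup>2 - z * t + 1 = 0"
  proof
    let ?r = "csqrt (z\<^sup>2 - 4)"
    have "((z + ?r) / 2)\<^sup>2 - z * ((z + ?r) / 2) + 1 = (?r\<^sup>2 - (z\<^sup>2 - 4)) / 4"
      by (simp only: power2_eq_square) (simp add: field_simps)
    then show "((z + ?r) / 2)\<^sup>2 - z * ((z + ?r) / 2) + 1 = 0" by simp
  qed
  then have "t \<noteq> 0" by auto
  define A :: "complex^2^2" where "A = vector [vector [x, -1], vector [1, 0]]"
  define B :: "complex^2^2" where "B = vector [vector [0, t], vector [- 1 / t, y]]"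
  have "det A = 1" "det B = 1"
    using \<open>t \<noteq> 0\<close> by (simp_all add: A_def B_def det_2)
  moreover have "t + 1 / t = z"
    using t \<open>t \<noteq> 0\<close> by (simp add: field_simps power2_eq_square)
  ultimately show ?thesis
    using that[of "Abs_SL2 A" "Abs_SL2 B"]
    by (simp add: tr_def Abs_SL2_inverse times_SL2.rep_eq trace_def matrix_matrix_mult_def sum_2
        A_def B_def add.commute)
qed

text \<open>Two candidates agree at every complex point by \<open>SL2_with_traces\<close>, hence as
  polynomials. This turns the definite description into a computation rule.\<close>

lemma trace_poly_eqI:
  assumes "\<And>A B. tr (word_map A B w) = eval_poly3 f (tr A) (tr B) (tr (A * B))"
  shows "trace_poly w = f"
  unfolding trace_poly_def
proof (rule the_equality)
  fix g
  assume g: "\<forall>A B. tr (word_map A B w) = eval_poly3 g (tr A) (tr B) (tr (A * B))"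
  have "eval_poly3 (g - f) x y z = 0" for x y z
  proof -
    obtain A B where "tr A = x" "tr B = y" "tr (A * B) = z" by (rule SL2_with_traces)
    then show ?thesis using g assms[of A B] by auto
  qed
  then show "g = f" using eval_poly3_eq_zero_imp[of "g - f"] by simp
qed (use assms in blast)

section \<open>Positive words and their coordinates\<close>

definition pos_word :: "letter list \<Rightarrow> F2" where
  "pos_word ls = (\<Prod>l\<leftarrow>ls. gen l)"

lemma pos_word_simps [simp]:
  "pos_word [] = 1" "pos_word (l # ls) = gen l * pos_word ls"
  "pos_word (us @ vs) = pos_word us * pos_word vs"
  by (simp_all add: pos_word_def)

lemma pos_word_replicate: "pos_word (replicate k l) = gen l ^ k"
  by (induction k) simp_all

lemma tr_mult_commute: "tr (A * B) = tr (B * A)"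
  by (simp add: tr_def times_SL2.rep_eq trace_def matrix_matrix_mult_def sum_2 algebra_simps)

text \<open>Traces are invariant under cyclic rotation, so both descriptions have the same defining
  predicate.\<close>

lemma trace_poly_rotate: "trace_poly (pos_word (us @ vs)) = trace_poly (pos_word (vs @ us))"
  unfolding trace_poly_def by (simp add: word_map_hom tr_mult_commute)

definition X :: poly3 where "X = Poly_Mapping.single (1, 0, 0) 1"
definition Y :: poly3 where "Y = Poly_Mapping.single (0, 1, 0) 1"
definition Z :: poly3 where "Z = Poly_Mapping.single (0, 0, 1) 1"

lemma eval_poly3_vars [simp]:
  "eval_poly3 X x y z = x" "eval_poly3 Y x y z = y" "eval_poly3 Z x y z = z"
  by (simp_all add: X_def Y_def Z_def eval_monom_def)

text \<open>\<open>coords ls\<close> holds the coordinates of the word \<open>ls\<close> with respect to \<open>1\<close>, \<open>B\<close>, \<open>A - x\<close>, \<open>A B\<close>.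
  With \<open>A\<close> in place of \<open>A - x\<close> the coordinate of \<open>1\<close> would have too large a degree.\<close>

fun coords :: "letter list \<Rightarrow> poly3 \<times> poly3 \<times> poly3 \<times> poly3" where
  "coords [] = (1, 0, 0, 0)"
| "coords (La # ls) = (case coords ls of (e, c1, c2, c3) \<Rightarrow> (X * e - c2, - c3, e, c1 + X * c3))"
| "coords (Lb # ls) =
    (case coords ls of (e, c1, c2, c3) \<Rightarrow> (Z * c2 - c1, e + Y * c1 + Z * c3, Y * c2 + c3, - c2))"

text \<open>The trace of the combination: the basis 1, B, A - x, AB has traces 2, y, x - 2x = -x,
  z.\<close>

definition trace_coords :: "poly3 \<times> poly3 \<times> poly3 \<times> poly3 \<Rightarrow> poly3" where
  "trace_coords = (\<lambda>(e, c1, c2, c3). e + e + Y * c1 - X * c2 + Z * c3)"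

lemma mat2_mult_entry:
  fixes m n :: "complex^2^2"
  shows "(m ** n)$i$j = m$i$1 * n$1$j + m$i$2 * n$2$j"
  by (simp add: matrix_matrix_mult_def sum_2)

lemma Cayley_Hamilton_entry:
  fixes m :: "complex^2^2"
  assumes "det m = 1"
  shows "(m ** m)$i$j = (m$1$1 + m$2$2) * m$i$j - mat 1$i$j"
proof -
  have [simp]: "(1::2) \<noteq> 2" "(2::2) \<noteq> 1" by simp_all
  have "m$1$1 * m$2$2 = 1 + m$1$2 * m$2$1"
    using assms by (simp add: det_2 algebra_simps)
  then show ?thesis
    using exhaust_2[of i] exhaust_2[of j]
    by (elim disjE; simp add: mat2_mult_entry mat_def algebra_simps)
qed

text \<open>Polarization of Cayley-Hamilton: the mixed part of det(a + b) is tr a tr b - tr(ab). It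
  serves to rewrite ba in terms of ab.\<close>

lemma Cayley_Hamilton_polar_entry:
  fixes a b :: "complex^2^2"
  shows "(b ** a)$i$j + (a ** b)$i$j = (a$1$1 + a$2$2) * b$i$j + (b$1$1 + b$2$2) * a$i$j
    + ((a ** b)$1$1 + (a ** b)$2$2 - (a$1$1 + a$2$2) * (b$1$1 + b$2$2)) * mat 1$i$j"
proof -
  have [simp]: "(1::2) \<noteq> 2" "(2::2) \<noteq> 1" by simp_all
  show ?thesis
    using exhaust_2[of i] exhaust_2[of j]
    by (elim disjE; simp add: mat2_mult_entry mat_def algebra_simps)
qed

text \<open>These are the products of a generator with 1, B, A, AB that leave the span and must be
  reduced; they yield the recursion of \<open>coords\<close>.\<close>

lemma SL2_entry_relations:
  fixes a b :: "complex^2^2" and i j :: 2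
  defines "x \<equiv> a$1$1 + a$2$2" and "y \<equiv> b$1$1 + b$2$2"
    and "z \<equiv> (a ** b)$1$1 + (a ** b)$2$2"
  assumes "det a = 1" "det b = 1"
  shows "(a ** a)$i$j = x * a$i$j - mat 1$i$j"
    and "(a ** (a ** b))$i$j = x * (a ** b)$i$j - b$i$j"
    and "(b ** b)$i$j = y * b$i$j - mat 1$i$j"
    and "(b ** a)$i$j = z * mat 1$i$j + y * (a$i$j - x * mat 1$i$j) - (a ** b)$i$j + x * b$i$j"
    and "(b ** (a ** b))$i$j = z * b$i$j + a$i$j - x * mat 1$i$j"
proof -
  have aa: "(a ** a)$i$j = x * a$i$j - mat 1$i$j" for i j
    using Cayley_Hamilton_entry[OF assms(4)] by (simp add: x_def)
  have bb: "(b ** b)$i$j = y * b$i$j - mat 1$i$j" for i j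
    using Cayley_Hamilton_entry[OF assms(5)] by (simp add: y_def)
  have ba: "(b ** a)$i$j = z * mat 1$i$j + y * (a$i$j - x * mat 1$i$j) - (a ** b)$i$j + x * b$i$j" for i j
  proof -
    have "(b ** a)$i$j = x * b$i$j + y * a$i$j + (z - x * y) * mat 1$i$j - (a ** b)$i$j"
      unfolding x_def y_def z_def Cayley_Hamilton_polar_entry[of b a i j, symmetric] by simp
    then show ?thesis by (simp only:) (simp add: algebra_simps)
  qed
  have left_id: "mat 1$i$1 * m$1$j + mat 1$i$2 * m$2$j = m$i$j"
    and right_id: "m$i$1 * mat 1$1$j + m$i$2 * mat 1$2$j = m$i$j" for i j and m :: "complex^2^2"
    using mat2_mult_entry[of "mat 1" m i j] mat2_mult_entry[of m "mat 1" i j] by simp_all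
  have "(a ** (a ** b))$i$j = (a ** a)$i$1 * b$1$j + (a ** a)$i$2 * b$2$j"
    by (simp only: matrix_mul_assoc mat2_mult_entry[of "a ** a" b])
  also have "\<dots> = x * (a ** b)$i$j - (mat 1$i$1 * b$1$j + mat 1$i$2 * b$2$j)"
    unfolding aa mat2_mult_entry[of a b] by (simp add: algebra_simps)
  finally show "(a ** (a ** b))$i$j = x * (a ** b)$i$j - b$i$j"
    unfolding left_id .
  have "((a ** b) ** b)$i$j = a$i$1 * (b ** b)$1$j + a$i$2 * (b ** b)$2$j"
    by (simp only: matrix_mul_assoc[symmetric] mat2_mult_entry[of a "b ** b"])
  also have "\<dots> = y * (a ** b)$i$j - (a$i$1 * mat 1$1$j + a$i$2 * mat 1$2$j)"
    unfolding bb mat2_mult_entry[of a b] by (simp add: algebra_simps)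
  finally have abb: "((a ** b) ** b)$i$j = y * (a ** b)$i$j - a$i$j"
    unfolding right_id .
  \<comment> \<open>Inserting the formula for ba into (ba)b, and then those for abb and bb, cancels
    the terms in xyb and yab.\<close>
  have "(b ** (a ** b))$i$j = (b ** a)$i$1 * b$1$j + (b ** a)$i$2 * b$2$j"
    by (simp only: matrix_mul_assoc mat2_mult_entry[of "b ** a" b])
  also have "\<dots> = (z - x * y) * (mat 1$i$1 * b$1$j + mat 1$i$2 * b$2$j) + y * (a ** b)$i$j
      - ((a ** b) ** b)$i$j + x * (b ** b)$i$j"
    unfolding ba mat2_mult_entry[of a b i j] mat2_mult_entry[of b b i j] mat2_mult_entry[of "a ** b" b i j]
    by (simp add: algebra_simps)
  finally show "(b ** (a ** b))$i$j = z * b$i$j + a$i$j - x * mat 1$i$j"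
    unfolding left_id abb bb by (simp add: algebra_simps)
  show "(a ** a)$i$j = x * a$i$j - mat 1$i$j" "(b ** b)$i$j = y * b$i$j - mat 1$i$j"
    "(b ** a)$i$j = z * mat 1$i$j + y * (a$i$j - x * mat 1$i$j) - (a ** b)$i$j + x * b$i$j"
    by (fact aa bb ba)+
qed

text \<open>Left multiplication by a letter is linear in the coordinates, so each induction step
  only applies the reduction relations to the basis.\<close>

lemma word_map_pos_word_entry:
  fixes A B :: SL2
  defines "a \<equiv> Rep_SL2 A" and "b \<equiv> Rep_SL2 B"
    and "evl \<equiv> \<lambda>f. eval_poly3 f (tr A) (tr B) (tr (A * B))"
  assumes "coords ls = (e, c1, c2, c3)"
  shows "Rep_SL2 (word_map A B (pos_word ls)) $ i $ j =
      evl e * mat 1 $ i $ j + evl c1 * b $ i $ j + evl c2 * (a $ i $ j - tr A * mat 1 $ i $ j)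
      + evl c3 * (a ** b) $ i $ j"
  using assms(4)
proof (induction ls arbitrary: e c1 c2 c3 i j)
  case Nil
  then show ?case by (auto simp: word_map_hom one_SL2.rep_eq evl_def)
next
  case (Cons l ls)
  obtain e' c1' c2' c3' where c': "coords ls = (e', c1', c2', c3')"
    by (metis prod_cases4)
  let ?W = "Rep_SL2 (word_map A B (pos_word ls))"
  have trs: "tr A = a$1$1 + a$2$2" "tr B = b$1$1 + b$2$2" "tr (A * B) = (a ** b)$1$1 + (a ** b)$2$2"
    by (simp_all add: tr_def trace_def a_def b_def times_SL2.rep_eq sum_2)
  have rels: "(a ** a)$i$j = tr A * a$i$j - mat 1$i$j"
    "(a ** (a ** b))$i$j = tr A * (a ** b)$i$j - b$i$j"
    "(b ** b)$i$j = tr B * b$i$j - mat 1$i$j"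
    "(b ** a)$i$j = tr (A * B) * mat 1$i$j + tr B * (a$i$j - tr A * mat 1$i$j) - (a ** b)$i$j + tr A * b$i$j"
    "(b ** (a ** b))$i$j = tr (A * B) * b$i$j + a$i$j - tr A * mat 1$i$j"
    unfolding trs by (rule SL2_entry_relations; use Rep_SL2[of A] Rep_SL2[of B] in \<open>simp add: a_def b_def\<close>)+
  have expand: "(m ** ?W)$i$j = evl e' * m$i$j + evl c1' * (m ** b)$i$j
      + evl c2' * ((m ** a)$i$j - tr A * m$i$j) + evl c3' * (m ** (a ** b))$i$j" for m
  proof -
    have "(m ** mat 1)$i$j = m$i$j" by simp
    then have id: "m$i$1 * mat 1$1$j + m$i$2 * mat 1$2$j = m$i$j"
      by (simp add: matrix_matrix_mult_def sum_2)
    have prod: "(m ** m')$i$j = m$i$1 * m'$1$j + m$i$2 * m'$2$j" for m' :: "complex^2^2"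
      by (simp add: matrix_matrix_mult_def sum_2)
    show ?thesis
      unfolding prod Cons.IH[OF c'] id[symmetric] by (simp add: algebra_simps)
  qed
  show ?case
  proof (cases l)
    case La
    have *: "e = X * e' - c2'" "c1 = - c3'" "c2 = e'" "c3 = c1' + X * c3'"
      using Cons.prems c' La by auto
    have "Rep_SL2 (word_map A B (pos_word (l # ls))) $ i $ j = (a ** ?W)$i$j"
      by (simp add: La word_map_hom times_SL2.rep_eq a_def)
    then show ?thesis
      unfolding expand rels * by (simp add: evl_def algebra_simps)
  next
    case Lb
    have *: "e = Z * c2' - c1'" "c1 = e' + Y * c1' + Z * c3'" "c2 = Y * c2' + c3'" "c3 = - c2'"
      using Cons.prems c' Lb by auto
    have "Rep_SL2 (word_map A B (pos_word (l # ls))) $ i $ j = (b ** ?W)$i$j"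
      by (simp add: Lb word_map_hom times_SL2.rep_eq b_def)
    then show ?thesis
      unfolding expand rels * by (simp add: evl_def algebra_simps)
  qed
qed

text \<open>Taking the trace of the coordinate expansion exhibits a trace polynomial, and uniqueness
  identifies it.\<close>

lemma trace_poly_pos_word: "trace_poly (pos_word ls) = trace_coords (coords ls)"
proof (rule trace_poly_eqI)
  fix A B
  obtain e c1 c2 c3 where c: "coords ls = (e, c1, c2, c3)"
    by (metis prod_cases4)
  have trs: "tr U = Rep_SL2 U $ 1 $ 1 + Rep_SL2 U $ 2 $ 2" for U
    by (simp add: tr_def trace_def sum_2)
  define x y z where "x = tr A" and "y = tr B" and "z = tr (A * B)"
  note entry = word_map_pos_word_entry[OF c, of A B, folded x_def y_def z_def]
  have diag: "mat 1 $ i $ i = (1 :: complex)" for i :: 2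
    by (simp add: mat_def)
  have "tr (word_map A B (pos_word ls))
      = 2 * eval_poly3 e x y z + eval_poly3 c1 x y z * tr B
        + eval_poly3 c2 x y z * (tr A - 2 * x) + eval_poly3 c3 x y z * tr (A * B)"
    unfolding trs entry diag times_SL2.rep_eq by (simp add: algebra_simps)
  then show "tr (word_map A B (pos_word ls)) = eval_poly3 (trace_coords (coords ls)) (tr A) (tr B) (tr (A * B))"
    unfolding x_def[symmetric] y_def[symmetric] z_def[symmetric]
    unfolding c trace_coords_def prod.case eval_poly3_add eval_poly3_diff eval_poly3_mult eval_poly3_vars
    by (simp add: algebra_simps)
qed

subsection \<open>The degree of the trace polynomial of a positive word\<close>

definition mdeg :: "nat \<times> nat \<times> nat \<Rightarrow> nat" where
  "mdeg m = fst m + fst (snd m) + snd (snd m)"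

text \<open>The bound is strict so that bound 0 characterizes the zero polynomial.\<close>

definition deg_less :: "poly3 \<Rightarrow> nat \<Rightarrow> bool" where
  "deg_less f k \<longleftrightarrow> (\<forall>m\<in>Poly_Mapping.keys f. mdeg m < k)"

text \<open>The top homogeneous part is a single monomial with coefficient 1. This survives
  multiplication by a variable and addition of lower terms, so no cancellation can lower the
  degree.\<close>

definition monic_deg :: "poly3 \<Rightarrow> nat \<Rightarrow> bool" where
  "monic_deg f k \<longleftrightarrow> (\<exists>m. mdeg m = k \<and> deg_less (f - Poly_Mapping.single m 1) k)"

lemma deg_less_zero [simp]: "deg_less 0 k"
  by (simp add: deg_less_def)

lemma deg_less_mono: "deg_less f k \<Longrightarrow> k \<le> k' \<Longrightarrow> deg_less f k'"
  by (auto simp: deg_less_def)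

lemma deg_less_minus [simp]: "deg_less (- f) k = deg_less f k"
  by (simp add: deg_less_def)

lemma deg_less_add: "deg_less f k \<Longrightarrow> deg_less g k \<Longrightarrow> deg_less (f + g) k"
  using keys_add[of f g] by (auto simp: deg_less_def)

lemma deg_less_diff: "deg_less f k \<Longrightarrow> deg_less g k \<Longrightarrow> deg_less (f - g) k"
  using deg_less_add[of f k "- g"] by simp

lemma deg_less_single_mult:
  assumes "mdeg v = 1" "deg_less f k"
  shows "deg_less (Poly_Mapping.single v 1 * f) (Suc k)"
proof -
  have "Poly_Mapping.keys (Poly_Mapping.single v (1::int)) = {v}" by simp
  then show ?thesis
    using keys_mult[of "Poly_Mapping.single v 1" f] assms
    by (fastforce simp: deg_less_def mdeg_def)
qed

lemma monic_deg_single_mult: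
  assumes "mdeg v = 1" "monic_deg f k"
  shows "monic_deg (Poly_Mapping.single v 1 * f) (Suc k)"
proof -
  obtain m where m: "mdeg m = k" "deg_less (f - Poly_Mapping.single m 1) k"
    using assms(2) by (auto simp: monic_deg_def)
  have "Poly_Mapping.single v 1 * f - Poly_Mapping.single (v + m) 1
      = Poly_Mapping.single v 1 * (f - Poly_Mapping.single m 1)"
    by (simp add: right_diff_distrib mult_single)
  moreover have "mdeg (v + m) = Suc k"
    using assms(1) m(1) by (simp add: mdeg_def)
  ultimately show ?thesis
    using deg_less_single_mult[OF assms(1) m(2)] by (metis monic_deg_def)
qed

lemmas deg_less_vars =
  deg_less_single_mult[of "(1, 0, 0)", folded X_def]
  deg_less_single_mult[of "(0, 1, 0)", folded Y_def]
  deg_less_single_mult[of "(0, 0, 1)", folded Z_def]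

lemmas monic_deg_vars =
  monic_deg_single_mult[of "(1, 0, 0)", folded X_def]
  monic_deg_single_mult[of "(0, 1, 0)", folded Y_def]
  monic_deg_single_mult[of "(0, 0, 1)", folded Z_def]

lemma mdeg_vars [simp]: "mdeg (1, 0, 0) = 1" "mdeg (0, 1, 0) = 1" "mdeg (0, 0, 1) = 1"
  by (simp_all add: mdeg_def)

lemma monic_deg_add: "monic_deg f k \<Longrightarrow> deg_less g k \<Longrightarrow> monic_deg (f + g) k"
  unfolding monic_deg_def by (metis add.commute add_diff_eq deg_less_add)

lemma monic_deg_diff: "monic_deg f k \<Longrightarrow> deg_less g k \<Longrightarrow> monic_deg (f - g) k"
  using monic_deg_add[of f k "- g"] by simp

lemma monic_deg_imp_deg_less:
  assumes "monic_deg f k"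
  shows "deg_less f (Suc k)"
proof -
  obtain m where m: "mdeg m = k" "deg_less (f - Poly_Mapping.single m 1) k"
    using assms by (auto simp: monic_deg_def)
  have "deg_less (Poly_Mapping.single m 1) (Suc k)"
    using m(1) by (simp add: deg_less_def)
  from deg_less_add[OF this deg_less_mono[OF m(2)]] show ?thesis by simp
qed

lemma monic_deg_one [simp]: "monic_deg 1 0"
  unfolding monic_deg_def by (rule exI[of _ 0]) (simp add: mdeg_def)

lemma total_degree_monic_deg:
  assumes "monic_deg f k"
  shows "total_degree f = k"
proof -
  obtain m where m: "mdeg m = k" "deg_less (f - Poly_Mapping.single m 1) k"
    using assms by (auto simp: monic_deg_def)
  \<comment> \<open>The remainder has only degrees below k, so it cannot cancel the monomial
    \<open>m\<close> of degree k.\<close>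
  have "m \<notin> Poly_Mapping.keys (f - Poly_Mapping.single m 1)"
    using m by (auto simp: deg_less_def)
  then have "m \<in> Poly_Mapping.keys f"
    by (simp add: in_keys_iff lookup_minus)
  moreover have "mdeg m' \<le> k" if "m' \<in> Poly_Mapping.keys f" for m'
    using monic_deg_imp_deg_less[OF assms] that by (auto simp: deg_less_def)
  moreover have "total_degree f = Max (insert 0 (mdeg ` Poly_Mapping.keys f))"
    unfolding total_degree_def
    by (rule arg_cong[of _ _ "\<lambda>S. Max (insert 0 S)"], rule image_cong) (auto simp: mdeg_def)
  ultimately show ?thesis
    using m(1) by (intro antisym) (auto intro!: Max.boundedI Max_ge)
qed

text \<open>The count is linear, not cyclic; the two agree for words ending in b, where no factor ab
  wraps around.\<close>

fun ab_count :: "letter list \<Rightarrow> nat" where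
  "ab_count (La # Lb # ls) = Suc (ab_count (Lb # ls))"
| "ab_count (_ # ls) = ab_count ls"
| "ab_count [] = 0"

lemma ab_count_Lb [simp]: "ab_count (Lb # ls) = ab_count ls"
  by (cases ls) auto

lemma ab_count_La: "ab_count (La # ls) = (if ls \<noteq> [] \<and> hd ls = Lb then Suc (ab_count ls) else ab_count ls)"
  by (cases ls; cases "hd ls") auto

text \<open>Reading from the right, the leading term sits at \<open>B\<close> as long as the word starts with \<open>b\<close>
  and at \<open>A B\<close> as long as it starts with \<open>a\<close>. It is multiplied by \<open>z\<close> when passing from \<open>A B\<close> to
  \<open>B\<close>, by \<open>1\<close> when passing from \<open>B\<close> to \<open>A B\<close>, and by \<open>x\<close> or \<open>y\<close> when the letter is repeated.\<close>

lemma coords_degrees: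
  assumes "coords (ls @ [Lb]) = (e, c1, c2, c3)"
  shows "\<exists>k. Suc k + ab_count (ls @ [Lb]) = Suc (length ls) \<and>
    (if hd (ls @ [Lb]) = Lb
     then deg_less e k \<and> monic_deg c1 k \<and> deg_less c2 k \<and> deg_less c3 (k - 1)
     else deg_less e (Suc k) \<and> deg_less c1 k \<and> deg_less c2 k \<and> monic_deg c3 k)"
  using assms
proof (induction ls arbitrary: e c1 c2 c3)
  case Nil
  then show ?case by auto
next
  case (Cons l ls)
  obtain e' c1' c2' c3' where c': "coords (ls @ [Lb]) = (e', c1', c2', c3')"
    by (metis prod_cases4)
  obtain k where k: "Suc k + ab_count (ls @ [Lb]) = Suc (length ls)"
    and d: "if hd (ls @ [Lb]) = Lb
     then deg_less e' k \<and> monic_deg c1' k \<and> deg_less c2' k \<and> deg_less c3' (k - 1)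
     else deg_less e' (Suc k) \<and> deg_less c1' k \<and> deg_less c2' k \<and> monic_deg c3' k"
    using Cons.IH[OF c'] by blast
  show ?case
  proof (cases l; cases "hd (ls @ [Lb])")
    assume l: "l = La" and h: "hd (ls @ [Lb]) = La"
    have eq: "e = X * e' - c2'" "c1 = - c3'" "c2 = e'" "c3 = c1' + X * c3'"
      using Cons.prems c' l by auto
    have d': "deg_less e' (Suc k)" "deg_less c1' k" "deg_less c2' k" "monic_deg c3' k"
      using d h by auto
    have "deg_less e (Suc (Suc k))"
      unfolding eq by (intro deg_less_diff deg_less_vars d' mdeg_vars deg_less_mono[OF d'(3)]) simp
    moreover have "deg_less c1 (Suc k)" "deg_less c2 (Suc k)"
      unfolding eq using d' by (auto intro: monic_deg_imp_deg_less)
    moreover have "monic_deg c3 (Suc k)"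
      unfolding eq add.commute[of c1']
      by (intro monic_deg_add monic_deg_vars d' mdeg_vars deg_less_mono[OF d'(2)]) simp
    ultimately show ?thesis
      using k h l by (intro exI[of _ "Suc k"]) (simp add: ab_count_La)
  next
    assume l: "l = La" and h: "hd (ls @ [Lb]) = Lb"
    have eq: "e = X * e' - c2'" "c1 = - c3'" "c2 = e'" "c3 = c1' + X * c3'"
      using Cons.prems c' l by auto
    have d': "deg_less e' k" "monic_deg c1' k" "deg_less c2' k" "deg_less c3' (k - 1)"
      using d h by auto
    have "deg_less e (Suc k)"
      unfolding eq by (intro deg_less_diff deg_less_vars d' mdeg_vars deg_less_mono[OF d'(3)]) simp
    moreover have "deg_less c1 k" "deg_less c2 k"
      unfolding eq using d' by (auto intro: deg_less_mono)
    \<comment> \<open>This keeps \<open>X * c3'\<close> below the leading term of \<open>c1'\<close>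
      and is why the invariant bounds \<open>c3\<close> by \<open>k - 1\<close>. For k = 0 the
      truncated bound is still 0 and forces \<open>c3'\<close> to vanish.\<close>
    moreover have "deg_less (X * c3') k"
    proof (cases k)
      case 0
      then have "c3' = 0" using d'(4) by (auto simp: deg_less_def simp flip: keys_eq_empty)
      then show ?thesis by simp
    qed (use deg_less_vars(1)[OF mdeg_vars(1) d'(4)] in simp)
    then have "monic_deg c3 k"
      unfolding eq using d'(2) by (intro monic_deg_add)
    ultimately show ?thesis
      using k h l by (intro exI[of _ k]) (simp add: ab_count_La)
  next
    assume l: "l = Lb" and h: "hd (ls @ [Lb]) = La"
    have eq: "e = Z * c2' - c1'" "c1 = e' + Y * c1' + Z * c3'" "c2 = Y * c2' + c3'" "c3 = - c2'"
      using Cons.prems c' l by auto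
    have d': "deg_less e' (Suc k)" "deg_less c1' k" "deg_less c2' k" "monic_deg c3' k"
      using d h by auto
    have "deg_less e (Suc k)"
      unfolding eq by (intro deg_less_diff deg_less_vars d' mdeg_vars deg_less_mono[OF d'(2)]) simp
    moreover have "monic_deg c1 (Suc k)"
      unfolding eq add.commute[of _ "Z * c3'"]
      by (intro monic_deg_add deg_less_add monic_deg_vars deg_less_vars d' mdeg_vars)
    moreover have "deg_less c2 (Suc k)"
      unfolding eq by (intro deg_less_add deg_less_vars d' mdeg_vars monic_deg_imp_deg_less)
    moreover have "deg_less c3 k"
      unfolding eq using d' by simp
    ultimately show ?thesis
      using k h l by (intro exI[of _ "Suc k"]) simp
  next
    assume l: "l = Lb" and h: "hd (ls @ [Lb]) = Lb"
    have eq: "e = Z * c2' - c1'" "c1 = e' + Y * c1' + Z * c3'" "c2 = Y * c2' + c3'" "c3 = - c2'"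
      using Cons.prems c' l by auto
    have d': "deg_less e' k" "monic_deg c1' k" "deg_less c2' k" "deg_less c3' (k - 1)"
      using d h by auto
    have d3: "deg_less c3' k"
      by (rule deg_less_mono[OF d'(4)]) simp
    have "deg_less e (Suc k)"
      unfolding eq by (intro deg_less_diff deg_less_vars d' mdeg_vars monic_deg_imp_deg_less)
    moreover have "monic_deg c1 (Suc k)"
      unfolding eq add.commute[of e'] add.assoc
      by (intro monic_deg_add deg_less_add monic_deg_vars deg_less_vars d' d3 mdeg_vars
          deg_less_mono[OF d'(1)]) simp
    moreover have "deg_less c2 (Suc k)"
      unfolding eq by (intro deg_less_add deg_less_vars d' mdeg_vars deg_less_mono[OF d3]) simp
    moreover have "deg_less c3 k"
      unfolding eq using d' by simp
    ultimately show ?thesis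
      using k h l by (intro exI[of _ "Suc k"]) simp
  qed
qed

text \<open>The trace multiplies the coordinate of B by y and that of AB by z, so the dominant one
  reaches degree k + 1 and stays monic, while all other terms have degree at most k.\<close>

lemma total_degree_pos_word_Lb:
  "total_degree (trace_poly (pos_word (ls @ [Lb]))) + ab_count (ls @ [Lb]) = Suc (length ls)"
proof -
  obtain e c1 c2 c3 where c: "coords (ls @ [Lb]) = (e, c1, c2, c3)"
    by (metis prod_cases4)
  obtain k where k: "Suc k + ab_count (ls @ [Lb]) = Suc (length ls)"
    and d: "if hd (ls @ [Lb]) = Lb
     then deg_less e k \<and> monic_deg c1 k \<and> deg_less c2 k \<and> deg_less c3 (k - 1)
     else deg_less e (Suc k) \<and> deg_less c1 k \<and> deg_less c2 k \<and> monic_deg c3 k"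
    using coords_degrees[OF c] by blast
  have e: "deg_less e (Suc k)" and c2: "deg_less c2 k"
    using d by (auto split: if_splits intro: deg_less_mono)
  have "monic_deg (e + e + Y * c1 - X * c2 + Z * c3) (Suc k)"
  proof (cases "hd (ls @ [Lb])")
    case La
    then have d': "deg_less c1 k" "monic_deg c3 k" using d by auto
    show ?thesis
      unfolding add.commute[of _ "Z * c3"]
      by (intro monic_deg_add deg_less_add deg_less_diff monic_deg_vars deg_less_vars d' c2 e mdeg_vars)
  next
    case Lb
    then have d': "monic_deg c1 k" "deg_less c3 (k - 1)" using d by auto
    have "deg_less c3 k" by (rule deg_less_mono[OF d'(2)]) simp
    then show ?thesis
      unfolding add.commute[of _ "Y * c1"]
      by (intro monic_deg_add monic_deg_diff deg_less_add monic_deg_vars deg_less_vars d' c2 e mdeg_vars)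
  qed
  then have "total_degree (trace_poly (pos_word (ls @ [Lb]))) = Suc k"
    unfolding trace_poly_pos_word c trace_coords_def prod.case by (rule total_degree_monic_deg)
  then show ?thesis using k by simp
qed

text \<open>Powers of a stay in the span of 1 and A - x, so here \<open>e\<close> dominates; it
  follows the recursion of the Chebyshev polynomials of the second kind in x/2.\<close>

lemma coords_replicate_La:
  "\<exists>e c2. coords (replicate n La) = (e, 0, c2, 0) \<and> monic_deg e n \<and> deg_less c2 n"
proof (induction n)
  case (Suc n)
  then obtain e c2 where *: "coords (replicate n La) = (e, 0, c2, 0)" "monic_deg e n" "deg_less c2 n"
    by blast
  have "monic_deg (X * e - c2) (Suc n)"
    by (intro monic_deg_diff monic_deg_vars mdeg_vars * deg_less_mono[OF *(3)]) simp
  then show ?case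
    using * by (auto intro: monic_deg_imp_deg_less)
qed auto

lemma total_degree_pos_word_replicate_La:
  assumes "n > 0"
  shows "total_degree (trace_poly (pos_word (replicate n La))) = n"
proof -
  obtain k where n: "n = Suc k" using assms by (cases n) auto
  obtain e c2 where *: "coords (replicate k La) = (e, 0, c2, 0)" "monic_deg e k" "deg_less c2 k"
    using coords_replicate_La[of k] by blast
  \<comment> \<open>From 2(xe - c2) - xe: the negative trace of A - x brings the leading coefficient
    2 down to 1.\<close>
  have "trace_poly (pos_word (replicate n La)) = X * e - (c2 + c2)"
    unfolding trace_poly_pos_word by (simp add: n * trace_coords_def algebra_simps)
  moreover have "monic_deg (X * e - (c2 + c2)) (Suc k)"
    by (intro monic_deg_diff monic_deg_vars mdeg_vars * deg_less_add deg_less_mono[OF *(3)]) simp_all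
  ultimately show ?thesis
    using total_degree_monic_deg n by simp
qed

text \<open>Only the seam can create a new factor ab.\<close>

lemma ab_count_append:
  "ab_count us + ab_count vs \<le> ab_count (us @ vs) \<and> ab_count (us @ vs) \<le> Suc (ab_count us + ab_count vs)"
proof (induction us)
  case (Cons l us)
  then show ?case
  proof (cases l)
    case La
    then show ?thesis
      using Cons by (cases us) (auto simp: ab_count_La)
  qed simp
qed simp

lemma ab_count_replicate [simp]: "ab_count (replicate k l) = 0"
  by (induction k; cases l) (auto simp: ab_count_La hd_replicate)

text \<open>Moving the trailing letters a to the front keeps the trace polynomial. Before and after,
  the count exceeds that of \<open>us @ [Lb]\<close> by 0 or 1, which explains the error 1.\<close>

lemma total_degree_pos_word:
  assumes "ls \<noteq> []"
  shows "\<bar>real (total_degree (trace_poly (pos_word ls))) - (real (length ls) - real (ab_count ls))\<bar> \<le> 1"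
proof (cases "Lb \<in> set ls")
  case True
  then obtain us vs where ls: "ls = us @ Lb # vs" and "Lb \<notin> set vs"
    using split_list_last by metis
  then have "\<forall>l\<in>set vs. l = La"
    by (metis letter.exhaust)
  then have vs: "vs = replicate (length vs) La"
    by (simp add: replicate_length_same)
  have "trace_poly (pos_word ls) = trace_poly (pos_word ((vs @ us) @ [Lb]))"
    using trace_poly_rotate[of "us @ [Lb]" vs] by (simp add: ls mult.assoc)
  moreover have "ab_count vs = 0" by (subst vs) simp
  moreover have "ab_count ls = ab_count ((us @ [Lb]) @ vs)" by (simp add: ls)
  ultimately show ?thesis
    using total_degree_pos_word_Lb[of "vs @ us"] ab_count_append[of vs "us @ [Lb]"]
      ab_count_append[of "us @ [Lb]" vs] by (simp del: pos_word_simps append_assoc) (simp add: ls, linarith)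
next
  case False
  then have "\<forall>l\<in>set ls. l = La"
    by (metis letter.exhaust)
  then have "ls = replicate (length ls) La"
    by (simp add: replicate_length_same)
  then show ?thesis
    using assms total_degree_pos_word_replicate_La[of "length ls"] ab_count_replicate[of "length ls" La]
    by auto
qed

subsection \<open>Concentration\<close>

text \<open>For t < 0 and u = -t the claim reads 1 \<le> (1 - u + u^2) exp u. Bounding exp u below
  by 1 + u + u^2/2 leaves a product equal to 1 plus nonnegative terms.\<close>

lemma exp_le_quadratic:
  fixes t :: real
  assumes "\<bar>t\<bar> \<le> 1"
  shows "exp t \<le> 1 + t + t\<^sup>2"
proof (cases "t \<ge> 0")
  case True
  then show ?thesis using exp_bound assms by simp
next
  case False
  define u where "u = - t"
  have u: "0 \<le> u" using False by (simp add: u_def)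
  have "1 \<le> 1 + u\<^sup>2 / 2 + u ^ 3 / 2 + u ^ 4 / 2"
    using u by simp
  also have "\<dots> = (1 - u + u\<^sup>2) * (1 + u + u\<^sup>2 / 2)"
    by (simp add: power2_eq_square power3_eq_cube power4_eq_xxxx field_simps)
  also have "\<dots> \<le> (1 - u + u\<^sup>2) * exp u"
  proof (intro mult_left_mono exp_lower_Taylor_quadratic u)
    show "0 \<le> 1 - u + u\<^sup>2"
      using assms False by (simp add: u_def)
  qed
  finally have "1 \<le> (1 + t + t\<^sup>2) * exp (- t)"
    by (simp add: u_def)
  then have "1 * exp t \<le> (1 + t + t\<^sup>2) * exp (- t) * exp t"
    by (intro mult_right_mono) simp_all
  also have "\<dots> = 1 + t + t\<^sup>2"
    by (simp add: mult.assoc flip: exp_add)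
  finally show ?thesis by simp
qed

text \<open>The quadratic bound on exp is averaged; the zero mean removes the linear term.\<close>

lemma two_point_mgf_bound:
  fixes p :: real
  assumes "0 \<le> p" "p \<le> 1" "\<bar>u\<bar> \<le> 1" "\<bar>v\<bar> \<le> 1" "p * u + (1 - p) * v = 0" "\<bar>t\<bar> \<le> 1"
  shows "p * exp (t * u) + (1 - p) * exp (t * v) \<le> exp (t\<^sup>2)"
proof -
  have bound: "exp (t * w) \<le> 1 + t * w + t\<^sup>2" if "\<bar>w\<bar> \<le> 1" for w
  proof -
    have "\<bar>t * w\<bar> \<le> 1"
      using mult_mono[OF assms(6) that] by (simp add: abs_mult)
    then have "exp (t * w) \<le> 1 + t * w + (t * w)\<^sup>2"
      by (rule exp_le_quadratic)
    also have "(t * w)\<^sup>2 \<le> t\<^sup>2"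
      using that by (simp add: power_mult_distrib mult_left_le abs_square_le_1)
    finally show ?thesis by simp
  qed
  have "p * exp (t * u) + (1 - p) * exp (t * v)
      \<le> p * (1 + t * u + t\<^sup>2) + (1 - p) * (1 + t * v + t\<^sup>2)"
    by (intro add_mono mult_left_mono bound) (use assms in auto)
  also have "\<dots> = 1 + t\<^sup>2 + t * (p * u + (1 - p) * v)"
    by (simp add: algebra_simps)
  also have "\<dots> \<le> exp (t\<^sup>2)"
    using assms(5) by simp
  finally show ?thesis .
qed

text \<open>The term for a leading \<open>b\<close> turns the centred count into a martingale
  with respect to prepending a random letter.\<close>

definition ab_martingale :: "real \<Rightarrow> letter list \<Rightarrow> real" where
  "ab_martingale p ls = real (ab_count ls) + (if ls \<noteq> [] \<and> hd ls = Lb then p else 0)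
     - real (length ls) * (p * (1 - p))"

lemma ab_martingale_step:
  assumes "0 \<le> p" "p \<le> 1" "\<bar>t\<bar> \<le> 1"
  shows "p * exp (t * ab_martingale p (La # ls)) + (1 - p) * exp (t * ab_martingale p (Lb # ls))
    \<le> exp (t\<^sup>2) * exp (t * ab_martingale p ls)"
proof -
  define u v where "u = ab_martingale p (La # ls) - ab_martingale p ls"
    and "v = ab_martingale p (Lb # ls) - ab_martingale p ls"
  have pp: "0 \<le> p * p" "p * p \<le> p"
    using assms(1,2) by (simp_all add: mult_left_le)
  \<comment> \<open>A leading b is worth p, the chance that the next letter is a. The increments are
    (1-p)^2 and -p(1-p) in front of b, and -p(1-p) and p^2 otherwise.\<close>
  have "p * u + (1 - p) * v = 0"
    by (auto simp: u_def v_def ab_martingale_def ab_count_La algebra_simps)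
  moreover have "\<bar>u\<bar> \<le> 1 \<and> \<bar>v\<bar> \<le> 1"
  proof (cases "ls \<noteq> [] \<and> hd ls = Lb")
    case True
    then have "u = 1 - 2 * p + p * p" "v = p * p - p"
      by (auto simp: u_def v_def ab_martingale_def ab_count_La algebra_simps)
    then show ?thesis using assms(1,2) pp by linarith
  next
    case False
    then have "u = p * p - p" "v = p * p"
      by (auto simp: u_def v_def ab_martingale_def ab_count_La algebra_simps)
    then show ?thesis using assms(1,2) pp by linarith
  qed
  ultimately have "p * exp (t * u) + (1 - p) * exp (t * v) \<le> exp (t\<^sup>2)"
    using assms by (intro two_point_mgf_bound) simp_all
  then have "(p * exp (t * u) + (1 - p) * exp (t * v)) * exp (t * ab_martingale p ls)
      \<le> exp (t\<^sup>2) * exp (t * ab_martingale p ls)"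
    by (rule mult_right_mono) simp
  then show ?thesis
    by (simp add: u_def v_def distrib_right mult.assoc algebra_simps flip: exp_add)
qed

section \<open>Exponential moments and tail bounds for random letter lists\<close>

lemma UNIV_letter: "UNIV = {La, Lb}"
  by (auto intro: letter.exhaust)

lemma finite_letters [simp]: "finite (A :: letter set)"
  by (rule finite_subset[OF subset_UNIV]) (simp add: UNIV_letter)

lemma pmf_letter_pmf:
  assumes "0 \<le> p" "p \<le> 1"
  shows "pmf (letter_pmf p) La = p" "pmf (letter_pmf p) Lb = 1 - p"
proof -
  have "(\<lambda>c. if c then La else Lb) -` {La} = {True}" "(\<lambda>c. if c then La else Lb) -` {Lb} = {False}"
    by (auto split: if_splits)
  then show "pmf (letter_pmf p) La = p" "pmf (letter_pmf p) Lb = 1 - p"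
    using assms by (simp_all add: letter_pmf_def pmf_map measure_pmf_single)
qed

abbreviation letters_pmf :: "real \<Rightarrow> nat \<Rightarrow> letter list pmf" where
  "letters_pmf p n \<equiv> replicate_pmf n (letter_pmf p)"

lemma finite_set_letters_pmf [simp]: "finite (set_pmf (letters_pmf p n))"
proof (rule finite_subset)
  show "set_pmf (letters_pmf p n) \<subseteq> {xs. set xs \<subseteq> UNIV \<and> length xs = n}"
    by (auto simp: set_replicate_pmf)
qed (rule finite_lists_length_eq, simp)

lemma expectation_letters_pmf_Suc:
  fixes f :: "letter list \<Rightarrow> real"
  assumes "0 \<le> p" "p \<le> 1"
  shows "measure_pmf.expectation (letters_pmf p (Suc n)) f
    = measure_pmf.expectation (letters_pmf p n) (\<lambda>ls. p * f (La # ls) + (1 - p) * f (Lb # ls))"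
proof -
  have "measure_pmf.expectation (letters_pmf p (Suc n)) f
      = measure_pmf.expectation (letter_pmf p \<bind> (\<lambda>l. map_pmf ((#) l) (letters_pmf p n))) f"
    unfolding map_pmf_def replicate_pmf.simps ..
  also have "\<dots> = (\<Sum>l\<in>{La, Lb}. pmf (letter_pmf p) l *\<^sub>R
      measure_pmf.expectation (map_pmf ((#) l) (letters_pmf p n)) f)"
    by (rule pmf_expectation_bind) (auto simp flip: UNIV_letter)
  also have "\<dots> = p * measure_pmf.expectation (letters_pmf p n) (\<lambda>ls. f (La # ls))
      + (1 - p) * measure_pmf.expectation (letters_pmf p n) (\<lambda>ls. f (Lb # ls))"
    by (simp add: pmf_letter_pmf[OF assms])
  also have "\<dots> = measure_pmf.expectation (letters_pmf p n) (\<lambda>ls. p * f (La # ls) + (1 - p) * f (Lb # ls))"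
    by (subst Bochner_Integration.integral_add) (auto intro!: integrable_measure_pmf_finite)
  finally show ?thesis .
qed

lemma ab_martingale_mgf:
  assumes "0 \<le> p" "p \<le> 1" "\<bar>t\<bar> \<le> 1"
  shows "measure_pmf.expectation (letters_pmf p n) (\<lambda>ls. exp (t * ab_martingale p ls)) \<le> exp (real n * t\<^sup>2)"
proof (induction n)
  case 0
  then show ?case by (simp add: ab_martingale_def)
next
  case (Suc n)
  have "measure_pmf.expectation (letters_pmf p (Suc n)) (\<lambda>ls. exp (t * ab_martingale p ls))
      \<le> measure_pmf.expectation (letters_pmf p n) (\<lambda>ls. exp (t\<^sup>2) * exp (t * ab_martingale p ls))"
    unfolding expectation_letters_pmf_Suc[OF assms(1,2)]
    by (intro integral_mono integrable_measure_pmf_finite finite_set_letters_pmf ab_martingale_step assms)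
  also have "\<dots> \<le> exp (t\<^sup>2) * exp (real n * t\<^sup>2)"
    using Suc.IH by simp
  also have "\<dots> = exp (real (Suc n) * t\<^sup>2)"
    by (simp add: algebra_simps flip: exp_add)
  finally show ?case .
qed

text \<open>Chernoff bound for both tails at once, as exp(t|S|) is at most exp(tS) + exp(-tS). The
  parameter t stays free for optimization.\<close>

lemma ab_martingale_tail:
  assumes "0 \<le> p" "p \<le> 1" "0 \<le> t" "t \<le> 1"
  shows "measure_pmf.prob (letters_pmf p n) {ls. \<bar>ab_martingale p ls\<bar> > r} \<le> 2 * exp (real n * t\<^sup>2 - t * r)"
proof -
  let ?E = "measure_pmf.expectation (letters_pmf p n)" and ?S = "ab_martingale p"
  note int = integrable_measure_pmf_finite[OF finite_set_letters_pmf]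
  have "measure_pmf.prob (letters_pmf p n) {ls. \<bar>?S ls\<bar> > r} = ?E (indicator {ls. \<bar>?S ls\<bar> > r})"
    by simp
  also have "\<dots> \<le> ?E (\<lambda>ls. exp (- (t * r)) * (exp (t * ?S ls) + exp (- t * ?S ls)))"
  proof (intro integral_mono int)
    fix ls
    have "1 \<le> exp (- (t * r)) * (exp (t * ?S ls) + exp (- t * ?S ls))" if "\<bar>?S ls\<bar> > r"
    proof -
      have "0 \<le> t * (\<bar>?S ls\<bar> - r)"
        using that assms(3) by simp
      then have "1 \<le> exp (- (t * r)) * exp (t * \<bar>?S ls\<bar>)"
        by (simp add: algebra_simps flip: exp_add)
      also have "\<dots> \<le> exp (- (t * r)) * (exp (t * ?S ls) + exp (- t * ?S ls))"
        by (intro mult_left_mono) (auto simp: abs_if)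
      finally show ?thesis .
    qed
    then show "indicator {ls. \<bar>?S ls\<bar> > r} ls \<le> exp (- (t * r)) * (exp (t * ?S ls) + exp (- t * ?S ls))"
      by (auto simp: indicator_def)
  qed
  also have "\<dots> = exp (- (t * r)) * (?E (\<lambda>ls. exp (t * ?S ls)) + ?E (\<lambda>ls. exp (- t * ?S ls)))"
    by (simp add: Bochner_Integration.integral_add int)
  also have "\<dots> \<le> exp (- (t * r)) * (exp (real n * t\<^sup>2) + exp (real n * (- t)\<^sup>2))"
    by (intro mult_left_mono add_mono ab_martingale_mgf) (use assms in auto)
  also have "\<dots> = 2 * exp (real n * t\<^sup>2 - t * r)"
    by (simp add: exp_diff exp_minus field_simps)
  finally show ?thesis .
qed

text \<open>The slack 2 has two sources: 1 from \<open>total_degree_pos_word\<close>, and 1 from the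
  leading-b term p in the martingale.\<close>

lemma total_degree_random_word_tail:
  assumes "0 \<le> p" "p \<le> 1" "0 \<le> t" "t \<le> 1" "n > 0"
  shows "measure_pmf.prob (random_positive_word p n)
      {w. \<bar>real (total_degree (trace_poly w)) - (1 - p * (1 - p)) * real n\<bar> \<le> r + 2}
    \<ge> 1 - 2 * exp (real n * t\<^sup>2 - t * r)"
proof -
  let ?M = "letters_pmf p n" and ?bad = "{ls. \<bar>ab_martingale p ls\<bar> > r}"
  let ?good = "{ls. \<bar>real (total_degree (trace_poly (pos_word ls))) - (1 - p * (1 - p)) * real n\<bar> \<le> r + 2}"
  have "1 - 2 * exp (real n * t\<^sup>2 - t * r) \<le> 1 - measure_pmf.prob ?M ?bad"
    using ab_martingale_tail[OF assms(1-4)] by simp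
  also have "\<dots> = measure_pmf.prob ?M (- ?bad)"
    using measure_pmf.prob_compl[of ?bad ?M] by (simp add: Compl_eq_Diff_UNIV)
  also have "\<dots> \<le> measure_pmf.prob ?M ?good"
  proof (intro measure_pmf.finite_measure_mono_AE AE_pmfI impI)
    fix ls
    assume "ls \<in> set_pmf ?M" and "ls \<in> - ?bad"
    then have len: "length ls = n" and S: "\<bar>ab_martingale p ls\<bar> \<le> r"
      by (auto simp: set_replicate_pmf)
    have "\<bar>real (ab_count ls) - real n * (p * (1 - p)) - ab_martingale p ls\<bar> \<le> 1"
      using assms(1,2) by (simp add: ab_martingale_def len)
    moreover have "\<bar>real (total_degree (trace_poly (pos_word ls))) - (real n - real (ab_count ls))\<bar> \<le> 1"
      using total_degree_pos_word[of ls] len assms(5) by auto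
    moreover have "(1 - p * (1 - p)) * real n = real n - real n * (p * (1 - p))"
      by (simp add: algebra_simps)
    ultimately show "ls \<in> ?good"
      using S by simp
  qed simp
  also have "\<dots> = measure_pmf.prob (random_positive_word p n)
      {w. \<bar>real (total_degree (trace_poly w)) - (1 - p * (1 - p)) * real n\<bar> \<le> r + 2}"
    by (simp add: random_positive_word_def pos_word_def vimage_def)
  finally show ?thesis .
qed

lemma total_degree_random_word_concentration:
  assumes "0 \<le> p" "p \<le> 1" "D > 0"
  shows "\<forall>\<^sub>F n in sequentially. measure_pmf.prob (random_positive_word p n)
      {w. \<bar>real (total_degree (trace_poly w)) - (1 - p * (1 - p)) * real n\<bar>
        \<le> (2 * sqrt D + 1) * sqrt (real n * ln (real n))}
    \<ge> 1 - 2 * real n powr (- D)"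
proof -
  \<comment> \<open>The first condition gives t \<le> 1; the second lets the summand 1 of the
    constant absorb the slack 2.\<close>
  have "\<forall>\<^sub>F n in sequentially. sqrt D * sqrt (ln (real n) / real n) < 1"
    by real_asymp
  moreover have "\<forall>\<^sub>F n in sequentially. sqrt (real n * ln (real n)) \<ge> 2"
    by real_asymp
  ultimately show ?thesis
    using eventually_gt_at_top[of 1]
  proof eventually_elim
    case (elim n)
    define L where "L = ln (real n)"
    \<comment> \<open>This t minimizes n t^2 - t r for the chosen r, with minimum -D ln n, which
      produces the factor n^(-D).\<close>
    define t where "t = sqrt D * sqrt (L / real n)"
    define r where "r = 2 * sqrt D * sqrt (real n * L)"
    have L: "0 \<le> L" and n: "0 < real n" using elim(3) by (auto simp: L_def)
    have t: "0 \<le> t" "t \<le> 1"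
      using elim(1) assms(3) L by (auto simp: t_def L_def)
    have "real n * t\<^sup>2 = D * L"
      using assms(3) L n by (simp add: t_def power_mult_distrib)
    moreover have "t * r = 2 * D * L"
    proof -
      have "sqrt (L / real n) * sqrt (real n * L) = L"
        using L n by (simp add: real_sqrt_divide real_sqrt_mult)
      moreover have "sqrt D * sqrt D = D"
        using assms(3) by simp
      moreover have "t * r = 2 * (sqrt D * sqrt D) * (sqrt (L / real n) * sqrt (real n * L))"
        unfolding t_def r_def by (simp only: mult_ac)
      ultimately show ?thesis by simp
    qed
    ultimately have "exp (real n * t\<^sup>2 - t * r) = real n powr (- D)"
      using n by (simp add: powr_def L_def)
    then have "1 - 2 * real n powr (- D) \<le> measure_pmf.prob (random_positive_word p n)
      {w. \<bar>real (total_degree (trace_poly w)) - (1 - p * (1 - p)) * real n\<bar> \<le> r + 2}"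
      using total_degree_random_word_tail[OF assms(1,2) t, of n r] elim(3) by simp
    also have "\<dots> \<le> measure_pmf.prob (random_positive_word p n)
      {w. \<bar>real (total_degree (trace_poly w)) - (1 - p * (1 - p)) * real n\<bar>
        \<le> (2 * sqrt D + 1) * sqrt (real n * ln (real n))}"
    proof (intro measure_pmf.finite_measure_mono subsetI)
      have "r + 2 \<le> (2 * sqrt D + 1) * sqrt (real n * ln (real n))"
        using elim(2) by (simp add: r_def L_def distrib_right)
      then show "w \<in> {w. \<bar>real (total_degree (trace_poly w)) - (1 - p * (1 - p)) * real n\<bar>
          \<le> (2 * sqrt D + 1) * sqrt (real n * ln (real n))}"
        if "w \<in> {w. \<bar>real (total_degree (trace_poly w)) - (1 - p * (1 - p)) * real n\<bar> \<le> r + 2}" for w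
        using that by simp
    qed simp
    finally show ?case .
  qed
qed

subsection \<open>Block form and degenerate letter distributions\<close>

text \<open>A seam after b creates no factor ab, so every block contributes exactly its inner
  one.\<close>

lemma ab_count_block:
  assumes "\<alpha> > 0" "\<beta> > 0"
  shows "ab_count (us @ [Lb] @ replicate \<alpha> La @ replicate \<beta> Lb) = Suc (ab_count (us @ [Lb]))"
    and "ab_count (replicate \<alpha> La @ replicate \<beta> Lb) = 1"
proof -
  have block: "ab_count (replicate (Suc k) La @ replicate \<beta> Lb) = 1" for k
    using assms(2) by (induction k) (auto simp: ab_count_La hd_append)
  then show *: "ab_count (replicate \<alpha> La @ replicate \<beta> Lb) = 1"
    using assms(1) by (metis Suc_pred)
  have append: "ab_count (us @ [Lb] @ vs) = ab_count (us @ [Lb]) + ab_count vs" for vs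
  proof (induction us)
    case (Cons l us)
    then show ?case by (cases l; cases us) (auto simp: ab_count_La)
  qed simp
  show "ab_count (us @ [Lb] @ replicate \<alpha> La @ replicate \<beta> Lb) = Suc (ab_count (us @ [Lb]))"
    unfolding append * by simp
qed

text \<open>The final b is split off to match the form required by
  \<open>total_degree_pos_word_Lb\<close>; the number of blocks becomes the number of factors
  ab.\<close>

lemma block_word:
  assumes "s \<ge> 1" "\<forall>i\<in>{1..s}. \<alpha> i > 0 \<and> \<beta> i > 0"
  shows "\<exists>ls. (\<Prod>i\<leftarrow>[1..<Suc s]. gen La ^ \<alpha> i * gen Lb ^ \<beta> i) = pos_word (ls @ [Lb])
    \<and> Suc (length ls) = (\<Sum>i=1..s. \<alpha> i + \<beta> i) \<and> ab_count (ls @ [Lb]) = s"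
  using assms
proof (induction s rule: nat_induct_at_least)
  case base
  then obtain k where k: "\<beta> (Suc 0) = Suc k" by (auto simp: gr0_conv_Suc)
  show ?case
    using base ab_count_block(2)[of "\<alpha> 1" "Suc k"]
    by (intro exI[of _ "replicate (\<alpha> 1) La @ replicate k Lb"])
       (simp add: k pos_word_replicate power_commutes replicate_append_same)
next
  case (Suc s)
  then obtain ls where ls: "(\<Prod>i\<leftarrow>[1..<Suc s]. gen La ^ \<alpha> i * gen Lb ^ \<beta> i) = pos_word (ls @ [Lb])"
    "Suc (length ls) = (\<Sum>i=1..s. \<alpha> i + \<beta> i)" "ab_count (ls @ [Lb]) = s"
    by auto
  have pos: "\<alpha> (Suc s) > 0" "\<beta> (Suc s) > 0" using Suc.prems by auto
  then obtain k where k: "\<beta> (Suc s) = Suc k" using gr0_implies_Suc by blast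
  let ?ls = "ls @ [Lb] @ replicate (\<alpha> (Suc s)) La @ replicate k Lb"
  have snoc: "?ls @ [Lb] = ls @ [Lb] @ replicate (\<alpha> (Suc s)) La @ replicate (\<beta> (Suc s)) Lb"
    by (simp add: k replicate_append_same)
  have "(\<Prod>i\<leftarrow>[1..<Suc (Suc s)]. gen La ^ \<alpha> i * gen Lb ^ \<beta> i) = pos_word (?ls @ [Lb])"
  proof -
    have "[1..<Suc (Suc s)] = [1..<Suc s] @ [Suc s]" by simp
    then show ?thesis
      unfolding snoc by (simp only: map_append prod_list.append ls(1)) (simp add: pos_word_replicate mult.assoc)
  qed
  moreover have "(\<Sum>i=1..Suc s. \<alpha> i + \<beta> i) = (\<Sum>i=1..s. \<alpha> i + \<beta> i) + (\<alpha> (Suc s) + \<beta> (Suc s))"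
    by (rule sum.cl_ivl_Suc[THEN trans]) simp
  then have "Suc (length ?ls) = (\<Sum>i=1..Suc s. \<alpha> i + \<beta> i)"
    unfolding ls(2)[symmetric] by (simp add: k)
  moreover have "ab_count (?ls @ [Lb]) = Suc s"
    unfolding snoc using ab_count_block(1)[OF pos] ls(3) by simp
  ultimately show ?case by blast
qed

lemma set_random_positive_word_degenerate:
  assumes "p = 0 \<or> p = 1" "w \<in> set_pmf (random_positive_word p n)"
  shows "\<exists>l. w = pos_word (replicate n l)"
proof -
  define l where "l = (if p = 0 then Lb else La)"
  have l: "l' = l" if "l' \<in> set_pmf (letter_pmf p)" for l'
    using that assms(1) by (cases l') (auto simp: l_def set_pmf_iff pmf_letter_pmf)
  from assms(2) have "w \<in> pos_word ` set_pmf (letters_pmf p n)"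
    unfolding random_positive_word_def pos_word_def set_map_pmf .
  then obtain ls where ls: "w = pos_word ls" "ls \<in> set_pmf (letters_pmf p n)"
    by (rule imageE)
  then have "length ls = n" "\<forall>l'\<in>set ls. l' = l"
    using l by (auto simp: set_replicate_pmf in_lists_conv_set)
  then have "ls = replicate n l"
    using replicate_length_same by metis
  then show ?thesis using ls(1) by blast
qed

lemma total_degree_pos_word_replicate:
  assumes "n > 0"
  shows "total_degree (trace_poly (pos_word (replicate n l))) = n"
proof (cases l)
  case Lb
  obtain k where "n = Suc k" using assms gr0_implies_Suc by blast
  then have n: "replicate n l = replicate k Lb @ [Lb]"
    by (simp add: Lb replicate_append_same)
  have "ab_count (replicate k Lb @ [Lb]) = 0"
    using ab_count_replicate[of "Suc k" Lb] by (simp add: replicate_append_same)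
  then show ?thesis
    using total_degree_pos_word_Lb[of "replicate k Lb"] \<open>n = Suc k\<close>
    unfolding n by simp
qed (use assms total_degree_pos_word_replicate_La in simp)

theorem theorem1p2:
  shows "(\<forall>(s::nat) (\<alpha> :: nat \<Rightarrow> nat) (\<beta> :: nat \<Rightarrow> nat) (w :: F2) (n::nat).
            s \<ge> 1 \<and> (\<forall>i\<in>{1..s}. \<alpha> i > 0 \<and> \<beta> i > 0)
              \<and> w = (\<Prod>i\<leftarrow>[1..<Suc s]. gen La ^ \<alpha> i * gen Lb ^ \<beta> i)
              \<and> n = (\<Sum>i=1..s. \<alpha> i + \<beta> i)
            \<longrightarrow> int (total_degree (trace_poly w)) = int n - int s)
       \<and> (\<forall>p::real. 0 < p \<and> p < 1 \<longrightarrow>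
            (\<forall>D::real. D > 0 \<longrightarrow>
              (\<exists>C > 0. \<exists>C' > 0. \<forall>\<^sub>F n in sequentially.
                 measure_pmf.prob (random_positive_word p n)
                   {w. \<bar>real (total_degree (trace_poly w)) - (1 - p * (1 - p)) * real n\<bar>
                         \<le> C * sqrt (real n * ln (real n))}
                 \<ge> 1 - C' * real n powr (- D))))
       \<and> (\<forall>p::real. p = 0 \<or> p = 1 \<longrightarrow>
            (\<forall>n\<ge>1. \<forall>w\<in>set_pmf (random_positive_word p n). total_degree (trace_poly w) = n))"
proof (intro conjI allI impI, goal_cases)
  case (1 s \<alpha> \<beta> w n)
  then obtain ls where "w = pos_word (ls @ [Lb])" "Suc (length ls) = n" "ab_count (ls @ [Lb]) = s"
    using block_word[of s \<alpha> \<beta>] by auto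
  then show ?case
    using total_degree_pos_word_Lb[of ls] by simp
next
  case (2 p D)
  \<comment> \<open>The constant C' = 2 counts the two tails; C is the one from the concentration
    lemma.\<close>
  then show ?case
    using total_degree_random_word_concentration[of p D]
    by (intro exI[of _ "2 * sqrt D + 1"] exI[of _ 2] conjI) (auto intro: add_nonneg_pos)
next
  case (3 p n)
  show ?case
  proof
    fix w
    assume "w \<in> set_pmf (random_positive_word p n)"
    then obtain l where "w = pos_word (replicate n l)"
      using set_random_positive_word_degenerate[OF 3(1)] by blast
    then show "total_degree (trace_poly w) = n"
      using total_degree_pos_word_replicate[of n l] 3(2) by simp
  qed
qed

end
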